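(* Let $G=(V,E)$ be a finite connected graph, $\ell\colon E\to(0,+\infty)$ an edge length function, $\Gamma$ the corresponding metric graph. Let $D$ be a $G$-admissible divisor on $\Gamma$ and $\mathbf{P}_D$ the corresponding semistability polytope. Assume that the spanning subgraph $G_D$ is connected. Then $\mathbf{P}_D$ is a translation of the Voronoi cell $\mathrm{Vor}_{G_D}$. More precisely, $$\mathbf{P}_D=\mathrm{Vor}_{G_D}+q_D.$$
   Context: $H_d=\{q\in\mathbb{R}^V:\sum_{v}q(v)=d\}$; for $q\in\mathbb{R}^V$ and $I\subseteq V$, $q(I)=\sum_{v\in I}q(v)$ and $I^c=V\setminus I$. The metric graph $\Gamma$ is obtained from $G$ by replacing each edge $e$ by an interval of length $\ell(e)$. A divisor is a finite formal sum $D=\sum_{x\in\Gamma}D(x)(x)$ with $D(x)\in\mathbb{Z}$; its degree is $d=\sum_xD(x)$. It is $G$-admissible if for each edge $e$ of $G$, $D$ vanishes at every point of the interior of $e$ with at most one exception $x$, for which $D(x)=1$. The graph $G_D$ is the spanning subgraph of $G$ (same vertex set $V$) whose edges are the edges of $G$ whose interiors contain no point of the support of $D$. For $I\subseteq V$, $\Gamma_I$ is the union of $I$ and all edges with both extremities in $I$, and $\deg(D_I):=\sum_{x\in\Gamma_I}D(x)$. Let $e(I,I^c)$ be the number of edges of $G$ joining $I$ to $I^c$, and $\delta_D(I,I^c)$ the number of those that contain a point of the support of $D$ in their interior. Semistability polytope: $\mathbf{P}_D:=\{q\in H_d:|\deg(D_I)-q(I)|\le\tfrac12e(I,I^c)\text{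 for each }\emptyset\subsetneq I\subsetneq V\}$. The point $q_D\in H_d$ is the element with $q_D(I)=\deg(D_I)+\tfrac12\delta_D(I,I^c)$ for all $I\subseteq V$ (the right-hand side is a modular function of $I$). Voronoi cell of a finite connected graph $G'$ with vertex set $V$ (applied to $G'=G_D$): let $\mathbb{E}'$ be the set of oriented edges of $G'$ (each edge with both orientations); for $e\in\mathbb{E}'$ with tail $\mathrm{t}_e$ and head $\mathrm{h}_e$ and $f\in\mathbb{R}^V$, put $\partial f(e)=f(\mathrm{t}_e)-f(\mathrm{h}_e)$. The Laplacian $\Delta\colon\mathbb{R}^V\to H_0$, $\Delta(f)(v)=\sum_{e\in\mathbb{E}',\,\mathrm{t}_e=v}\partial f(e)$, is surjective, and $\Delta(\mathbb{Z}^V)$ is a full rank lattice in $H_0$. For $h\in H_0$ define $\|h\|^2:=\frac12\sum_{e\in\mathbb{E}'}\partial f(e)^2$ for any $f$ with $\Delta(f)=h$ (independent of $f$). Then $\mathrm{Vor}_{G'}:=\{h\in H_0:\|h\|^2\le\|h-\lambda\|^2\ \forall\lambda\in\Delta(\mathbb{Z}^V)\}$. *)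

theory Defs
  imports
    "HOL-Library.Poly_Mapping"
    "HOL-Analysis.Analysis"
    "Graph_Theory.Digraph_Component"
begin

text \<open>
  An undirected multigraph (loops and parallel edges allowed) on the vertex set \<open>UNIV :: 'v set\<close>
  is given by a \<open>pre_digraph\<close>: each undirected edge is recorded as one arc, whose direction is an
  arbitrary reference orientation. That orientation is used only to name the points in the interior
  of an edge and to list the two oriented edges lying over it. Connectedness is
  \<open>Digraph_Component.connected\<close>, i.e. that of the underlying undirected graph. The space of real
  functions on the vertices is \<open>real ^ 'v\<close>.
\<close>

definition vsum :: "real ^ 'v::finite \<Rightarrow> 'v set \<Rightarrow> real" where
  "vsum q I = (\<Sum>v\<in>I. q $ v)"

definition hyperplane_deg :: "real \<Rightarrow> (real ^ 'v::finite) set" where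
  "hyperplane_deg d = {q. vsum q UNIV = d}"

text \<open>
  The edge \<open>e\<close> is replaced by a segment \<open>[0, len e]\<close> with \<open>0\<close> glued to the tail and \<open>len e\<close> to
  the head; \<open>Interior e t\<close> is the point at distance \<open>t\<close> from the tail end, for \<open>0 < t < len e\<close>.
\<close>

datatype ('v, 'e) mpoint = Vertex 'v | Interior 'e real

definition edge_interior :: "('e \<Rightarrow> real) \<Rightarrow> 'e \<Rightarrow> ('v, 'e) mpoint set" where
  "edge_interior len e = Interior e ` {0<..<len e}"

definition sub_metric_graph ::
    "('v, 'e) pre_digraph \<Rightarrow> ('e \<Rightarrow> real) \<Rightarrow> 'v set \<Rightarrow> ('v, 'e) mpoint set" where
  "sub_metric_graph G len I =
     Vertex ` I \<union> (\<Union>e\<in>{e \<in> arcs G. tail G e \<in> I \<and> head G e \<in> I}. edge_interior len e)"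

definition metric_graph :: "('v, 'e) pre_digraph \<Rightarrow> ('e \<Rightarrow> real) \<Rightarrow> ('v, 'e) mpoint set" where
  "metric_graph G len = Vertex ` verts G \<union> (\<Union>e\<in>arcs G. edge_interior len e)"

text \<open>A divisor is a finitely supported integer-valued function; its support is \<open>keys D\<close>.\<close>

definition is_divisor ::
    "('v, 'e) pre_digraph \<Rightarrow> ('e \<Rightarrow> real) \<Rightarrow> (('v, 'e) mpoint \<Rightarrow>\<^sub>0 int) \<Rightarrow> bool" where
  "is_divisor G len D \<longleftrightarrow> Poly_Mapping.keys D \<subseteq> metric_graph G len"

definition deg_on :: "('p \<Rightarrow>\<^sub>0 int) \<Rightarrow> 'p set \<Rightarrow> int" where
  "deg_on D X = (\<Sum>x\<in>Poly_Mapping.keys D \<inter> X. Poly_Mapping.lookup D x)"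

definition divisor_degree ::
    "('v, 'e) pre_digraph \<Rightarrow> ('e \<Rightarrow> real) \<Rightarrow> (('v, 'e) mpoint \<Rightarrow>\<^sub>0 int) \<Rightarrow> int" where
  "divisor_degree G len D = deg_on D (metric_graph G len)"

definition deg_sub ::
    "('v, 'e) pre_digraph \<Rightarrow> ('e \<Rightarrow> real) \<Rightarrow> (('v, 'e) mpoint \<Rightarrow>\<^sub>0 int) \<Rightarrow> 'v set \<Rightarrow> int" where
  "deg_sub G len D I = deg_on D (sub_metric_graph G len I)"

definition admissible ::
    "('v, 'e) pre_digraph \<Rightarrow> ('e \<Rightarrow> real) \<Rightarrow> (('v, 'e) mpoint \<Rightarrow>\<^sub>0 int) \<Rightarrow> bool" where
  "admissible G len D \<longleftrightarrow>
     (\<forall>e\<in>arcs G.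
        (\<forall>y\<in>edge_interior len e. Poly_Mapping.lookup D y = 0) \<or>
        (\<exists>x\<in>edge_interior len e. Poly_Mapping.lookup D x = 1 \<and>
           (\<forall>y\<in>edge_interior len e - {x}. Poly_Mapping.lookup D y = 0)))"

definition meets_support :: "('e \<Rightarrow> real) \<Rightarrow> (('v, 'e) mpoint \<Rightarrow>\<^sub>0 int) \<Rightarrow> 'e \<Rightarrow> bool" where
  "meets_support len D e \<longleftrightarrow> edge_interior len e \<inter> Poly_Mapping.keys D \<noteq> {}"

definition support_free_subgraph ::
    "('v, 'e) pre_digraph \<Rightarrow> ('e \<Rightarrow> real) \<Rightarrow> (('v, 'e) mpoint \<Rightarrow>\<^sub>0 int) \<Rightarrow> ('v, 'e) pre_digraph" where
  "support_free_subgraph G len D =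
     \<lparr>verts = verts G, arcs = {e \<in> arcs G. \<not> meets_support len D e}, tail = tail G, head = head G\<rparr>"

definition cut_edges :: "('v, 'e) pre_digraph \<Rightarrow> 'v set \<Rightarrow> 'e set" where
  "cut_edges G I =
     {e \<in> arcs G. tail G e \<in> I \<and> head G e \<in> - I \<or> tail G e \<in> - I \<and> head G e \<in> I}"

definition semistability_polytope ::
    "('v::finite, 'e) pre_digraph \<Rightarrow> ('e \<Rightarrow> real) \<Rightarrow> (('v, 'e) mpoint \<Rightarrow>\<^sub>0 int) \<Rightarrow> (real ^ 'v) set" where
  "semistability_polytope G len D =
     {q \<in> hyperplane_deg (of_int (divisor_degree G len D)).
        \<forall>I. I \<noteq> {} \<and> I \<noteq> UNIV \<longrightarrow>
          \<bar>of_int (deg_sub G len D I) - vsum q I\<bar> \<le> 1 / 2 * real (card (cut_edges G I))}"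

definition q_point ::
    "('v::finite, 'e) pre_digraph \<Rightarrow> ('e \<Rightarrow> real) \<Rightarrow> (('v, 'e) mpoint \<Rightarrow>\<^sub>0 int) \<Rightarrow> real ^ 'v" where
  "q_point G len D =
     (THE q. q \<in> hyperplane_deg (of_int (divisor_degree G len D)) \<and>
        (\<forall>I. vsum q I = of_int (deg_sub G len D I)
              + 1 / 2 * real (card {e \<in> cut_edges G I. meets_support len D e})))"

text \<open>
  Oriented edges: \<open>(e, True)\<close> is the arc \<open>e\<close> with its reference orientation, \<open>(e, False)\<close> the
  reversed one. A loop thus has two orientations as well.
\<close>

definition oriented_edges :: "('v, 'e) pre_digraph \<Rightarrow> ('e \<times> bool) set" where
  "oriented_edges G = arcs G \<times> UNIV"

definition otail :: "('v, 'e) pre_digraph \<Rightarrow> 'e \<times> bool \<Rightarrow> 'v" where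
  "otail G a = (if snd a then tail G (fst a) else head G (fst a))"

definition ohead :: "('v, 'e) pre_digraph \<Rightarrow> 'e \<times> bool \<Rightarrow> 'v" where
  "ohead G a = (if snd a then head G (fst a) else tail G (fst a))"

definition coboundary :: "('v::finite, 'e) pre_digraph \<Rightarrow> real ^ 'v \<Rightarrow> 'e \<times> bool \<Rightarrow> real" where
  "coboundary G f a = f $ otail G a - f $ ohead G a"

definition laplacian :: "('v::finite, 'e) pre_digraph \<Rightarrow> real ^ 'v \<Rightarrow> real ^ 'v" where
  "laplacian G f = (\<chi> v. \<Sum>a\<in>{a \<in> oriented_edges G. otail G a = v}. coboundary G f a)"

definition laplacian_lattice :: "('v::finite, 'e) pre_digraph \<Rightarrow> (real ^ 'v) set" where
  "laplacian_lattice G = laplacian G ` {f. \<forall>v. f $ v \<in> \<int>}"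

text \<open>
  \<open>energy_sq G h\<close> is the squared norm of \<open>h\<close>. For connected \<open>G\<close> and \<open>h\<close> of degree \<open>0\<close> a
  potential \<open>f\<close> with \<open>laplacian G f = h\<close> exists and is unique up to an additive constant, so the
  value does not depend on the choice.
\<close>

definition energy_sq :: "('v::finite, 'e) pre_digraph \<Rightarrow> real ^ 'v \<Rightarrow> real" where
  "energy_sq G h =
     (let f = (SOME f. laplacian G f = h)
      in 1 / 2 * (\<Sum>a\<in>oriented_edges G. (coboundary G f a)\<^sup>2))"

definition voronoi_cell :: "('v::finite, 'e) pre_digraph \<Rightarrow> (real ^ 'v) set" where
  "voronoi_cell G =
     {h \<in> hyperplane_deg 0. \<forall>l\<in>laplacian_lattice G. energy_sq G h \<le> energy_sq G (h - l)}"

end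

theory Submission
  imports Defs
begin

text \<open>
  Both sides of the asserted equality are cut out of a hyperplane by inequalities indexed by vertex
  sets, and the proof consists in recognising that these inequalities agree.

  On the polytope side, put \<open>q = h + q_D\<close>. The semistability inequality for \<open>I\<close> compares
  \<open>h(I)\<close> with \<open>\<plusminus> e(I, I\<^sup>c) / 2\<close>, off centre by \<open>\<delta>\<^sub>D(I, I\<^sup>c) / 2\<close>. One half of it says that \<open>h(I)\<close> is
  at most half the size of the cut of \<open>I\<close> in \<open>G\<^sub>D\<close>. The other half is weaker than
  this same bound for the complement of \<open>I\<close>, as \<open>h(I\<^sup>c) = - h(I)\<close>. Hence the polytope is
  the translate by \<open>q_D\<close> of the set of all \<open>h\<close> of degree \<open>0\<close> satisfying these cut inequalities.

  On the Voronoi side, the norm comes from the Dirichlet form \<open>\<langle>f, g\<rangle> = \<Sum>\<^sub>e \<partial>f(e) \<partial>g(e)\<close>, which satisfies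
  \<open>\<Delta> f \<bullet> g = \<langle>f, g\<rangle>\<close>. As \<open>\<Delta>\<close> maps onto the degree \<open>0\<close> hyperplane, expanding a
  square turns membership in the cell into the inequalities \<open>h \<bullet> g \<le> \<langle>g, g\<rangle> / 2\<close> for all integral
  \<open>g\<close>. If \<open>g\<close> is the indicator of \<open>I\<close>, this is the cut inequality of \<open>I\<close>. Conversely, an integral \<open>g\<close> is,
  up to a constant, the sum of the indicators of its superlevel sets; adding up the cut inequalities
  of these sets bounds \<open>h \<bullet> g\<close> by \<open>\<Sum>\<^sub>e \<bar>\<partial>g(e)\<bar> / 2\<close>, because every edge \<open>e\<close> crosses exactly
  \<open>\<bar>\<partial>g(e)\<bar>\<close> of the superlevel sets, and \<open>\<bar>n\<bar> \<le> n\<^sup>2\<close> for integers. So the Voronoi cell is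
  given by the cut inequalities as well.
\<close>

section \<open>The Dirichlet form and the energy norm\<close>

definition dirichlet_form ::
    "('v::finite, 'e) pre_digraph \<Rightarrow> real ^ 'v \<Rightarrow> real ^ 'v \<Rightarrow> real" where
  "dirichlet_form G f g =
     (\<Sum>e\<in>arcs G. (f $ tail G e - f $ head G e) * (g $ tail G e - g $ head G e))"

lemma dirichlet_form_commute: "dirichlet_form G f g = dirichlet_form G g f"
  by (simp add: dirichlet_form_def mult.commute)

lemma dirichlet_form_diff:
  "dirichlet_form G (f - g) (f - g)
     = dirichlet_form G f f - 2 * dirichlet_form G f g + dirichlet_form G g g"
  by (simp add: dirichlet_form_def sum_distrib_left flip: sum_subtractf sum.distrib)
     (simp add: algebra_simps)

lemma sum_oriented_edges:
  fixes G :: "('v, 'e) pre_digraph" and F :: "'e \<times> bool \<Rightarrow> real"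
  shows "(\<Sum>a\<in>oriented_edges G. F a) = (\<Sum>e\<in>arcs G. F (e, True) + F (e, False))"
proof -
  have "(\<Sum>a\<in>oriented_edges G. F a) = (\<Sum>e\<in>arcs G. \<Sum>b\<in>UNIV. F (e, b))"
    unfolding oriented_edges_def
    by (simp add: sum.cartesian_product)
  then show ?thesis
    by (simp add: UNIV_bool add.commute)
qed

lemma inner_laplacian:
  fixes G :: "('v::finite, 'e) pre_digraph"
  assumes "finite (arcs G)"
  shows "laplacian G f \<bullet> g = dirichlet_form G f g"
proof -
  have fin: "finite (oriented_edges G)"
    using assms by (simp add: oriented_edges_def)
  have "laplacian G f \<bullet> g
      = (\<Sum>v\<in>UNIV. \<Sum>a\<in>{a \<in> oriented_edges G. otail G a = v}. coboundary G f a * g $ otail G a)"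
    by (auto simp: inner_vec_def laplacian_def sum_distrib_right intro!: sum.cong)
  also have "\<dots> = (\<Sum>a\<in>oriented_edges G. coboundary G f a * g $ otail G a)"
    using fin by (intro sum.group) auto
  also have "\<dots> = dirichlet_form G f g"
    unfolding sum_oriented_edges dirichlet_form_def
    by (rule sum.cong) (auto simp: coboundary_def otail_def ohead_def algebra_simps)
  finally show ?thesis .
qed

lemma linear_laplacian: "linear (laplacian G)"
proof (rule linearI)
  show "laplacian G (f + g) = laplacian G f + laplacian G g" for f g
    by (simp add: vec_eq_iff laplacian_def coboundary_def algebra_simps
        flip: sum.distrib)
  show "laplacian G (c *\<^sub>R f) = c *\<^sub>R laplacian G f" for c f
    by (simp add: vec_eq_iff laplacian_def coboundary_def algebra_simps sum_distrib_left)
qed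

text \<open>
  Any potential computes the energy: if \<open>f\<close> and \<open>f'\<close> have the same Laplacian \<open>h\<close>, then both energies
  equal \<open>\<langle>f, f'\<rangle>\<close> by symmetry of the Dirichlet form.
\<close>

lemma energy_sq_laplacian:
  fixes G :: "('v::finite, 'e) pre_digraph"
  assumes "finite (arcs G)"
  shows "energy_sq G (laplacian G f) = dirichlet_form G f f"
proof -
  define f' where "f' = (SOME f'. laplacian G f' = laplacian G f)"
  have f': "laplacian G f' = laplacian G f"
    unfolding f'_def by (rule someI[where x = f]) simp
  have "energy_sq G (laplacian G f) = dirichlet_form G f' f'"
    unfolding energy_sq_def Let_def f'_def[symmetric] sum_oriented_edges dirichlet_form_def
    by (simp add: coboundary_def otail_def ohead_def sum_distrib_left power2_eq_square algebra_simps)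
  also have "\<dots> = dirichlet_form G f f'"
    by (metis inner_laplacian[OF assms] f')
  also have "\<dots> = dirichlet_form G f f"
    by (metis inner_laplacian[OF assms] f' dirichlet_form_commute)
  finally show ?thesis .
qed

section \<open>Surjectivity of the Laplacian onto degree zero\<close>

lemma connected_constant:
  fixes G :: "('v, 'e) pre_digraph"
  assumes "Digraph_Component.connected G"
    and "\<And>e. e \<in> arcs G \<Longrightarrow> f (tail G e) = f (head G e)"
    and "u \<in> verts G" "v \<in> verts G"
  shows "f u = f v"
proof -
  have "u \<rightarrow>\<^sup>*\<^bsub>with_proj (mk_symmetric G)\<^esub> v"
    using assms by (auto simp: connected_def strongly_connected_def)
  then have "(u, v) \<in> rtrancl_on (verts G) (parcs (mk_symmetric G))"
    by (simp add: reachable_def)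
  then show ?thesis
    by (induction rule: rtrancl_on_induct) (use assms(2) in \<open>auto simp: parcs_mk_symmetric\<close>)
qed

lemma laplacian_degree_zero:
  fixes G :: "('v::finite, 'e) pre_digraph"
  assumes "finite (arcs G)"
  shows "laplacian G f \<in> hyperplane_deg 0"
proof -
  have "vsum (laplacian G f) UNIV = laplacian G f \<bullet> 1"
    by (simp add: vsum_def inner_vec_def)
  also have "\<dots> = 0"
    using assms by (simp add: inner_laplacian dirichlet_form_def)
  finally show ?thesis
    by (simp add: hyperplane_deg_def)
qed

text \<open>
  The Laplacian is self-adjoint, so the component of \<open>h\<close> orthogonal to its range is harmonic. Harmonic
  functions have zero energy and are constant by connectedness, and degree \<open>0\<close> means orthogonality
  to the constants.
\<close>

lemma laplacian_surj_degree_zero: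
  fixes G :: "('v::finite, 'e) pre_digraph"
  assumes fin: "finite (arcs G)" and verts: "verts G = UNIV"
    and conn: "Digraph_Component.connected G"
    and h: "h \<in> hyperplane_deg 0"
  obtains f where "laplacian G f = h"
proof -
  have sub: "span (range (laplacian G)) = range (laplacian G)"
    by (simp add: linear_subspace_image[OF linear_laplacian] span_eq_iff)
  obtain y z where y: "y \<in> span (range (laplacian G))"
    and z: "\<And>w. w \<in> span (range (laplacian G)) \<Longrightarrow> orthogonal z w" and hyz: "h = y + z"
    using orthogonal_subspace_decomp_exists[of "range (laplacian G)" h] by metis
  have z_orth: "laplacian G g \<bullet> z = 0" for g
    using z[of "laplacian G g"] by (simp add: sub orthogonal_def inner_commute)
  have "dirichlet_form G z z = 0"
    using z_orth[of z] inner_laplacian[OF fin] by metis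
  then have "z $ tail G e = z $ head G e" if "e \<in> arcs G" for e
    using that fin by (simp add: dirichlet_form_def sum_nonneg_eq_0_iff)
  then have const: "z $ u = z $ v" for u v
    using connected_constant[OF conn, of "($) z" u v] verts by simp
  obtain c where c: "\<And>v. z $ v = c"
    using const by metis
  have "h \<bullet> z = c * vsum h UNIV"
    by (simp add: inner_vec_def c vsum_def sum_distrib_left mult.commute)
  then have "h \<bullet> z = 0"
    using h by (simp add: hyperplane_deg_def)
  moreover have "y \<bullet> z = 0"
    using z[OF y] by (simp add: orthogonal_def inner_commute)
  ultimately have "z = 0"
    by (simp add: hyz inner_add_left)
  then show ?thesis
    using that y hyz by (auto simp: sub)
qed

section \<open>The Voronoi cell is cut out by the cut inequalities\<close>

text \<open>
  The one-sided inequalities bound \<open>\<bar>h(I)\<bar>\<close>, since in degree \<open>0\<close> passing to the complement of \<open>I\<close>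
  changes the sign of \<open>h(I)\<close> and keeps the cut.
\<close>

definition cut_polytope :: "('v::finite, 'e) pre_digraph \<Rightarrow> (real ^ 'v) set" where
  "cut_polytope G = {h \<in> hyperplane_deg 0. \<forall>I. vsum h I \<le> 1 / 2 * real (card (cut_edges G I))}"

lemma voronoi_cell_iff:
  fixes G :: "('v::finite, 'e) pre_digraph"
  assumes fin: "finite (arcs G)" and verts: "verts G = UNIV"
    and conn: "Digraph_Component.connected G"
  shows "h \<in> voronoi_cell G \<longleftrightarrow>
    h \<in> hyperplane_deg 0 \<and> (\<forall>g. (\<forall>v. g $ v \<in> \<int>) \<longrightarrow> h \<bullet> g \<le> 1 / 2 * dirichlet_form G g g)"
proof (cases "h \<in> hyperplane_deg 0")
  case True
  then obtain f where f: "laplacian G f = h"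
    using laplacian_surj_degree_zero[OF fin verts conn] by blast
  have "energy_sq G h \<le> energy_sq G (h - laplacian G g)
      \<longleftrightarrow> h \<bullet> g \<le> 1 / 2 * dirichlet_form G g g" for g
  proof -
    have "energy_sq G (h - laplacian G g) = dirichlet_form G (f - g) (f - g)"
      using energy_sq_laplacian[OF fin, of "f - g"] by (simp add: linear_diff[OF linear_laplacian] f)
    then show ?thesis
      by (simp add: energy_sq_laplacian[OF fin] dirichlet_form_diff inner_laplacian[OF fin] mult.commute flip: f)
  qed
  with True show ?thesis
    by (auto simp: voronoi_cell_def laplacian_lattice_def)
qed (simp add: voronoi_cell_def)

lemma dirichlet_form_indicator:
  fixes G :: "('v::finite, 'e) pre_digraph"
  assumes "finite (arcs G)"
  shows "dirichlet_form G (\<chi> v. of_bool (v \<in> I)) (\<chi> v. of_bool (v \<in> I)) = real (card (cut_edges G I))"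
proof -
  have "dirichlet_form G (\<chi> v. of_bool (v \<in> I)) (\<chi> v. of_bool (v \<in> I))
      = (\<Sum>e\<in>arcs G. if e \<in> cut_edges G I then 1 else 0)"
    unfolding dirichlet_form_def by (rule sum.cong) (auto simp: cut_edges_def)
  also have "\<dots> = real (card (arcs G \<inter> cut_edges G I))"
    using assms by (simp flip: sum.inter_restrict)
  also have "arcs G \<inter> cut_edges G I = cut_edges G I"
    by (auto simp: cut_edges_def)
  finally show ?thesis .
qed

text \<open>Layer-cake decomposition: both sides are summed over the superlevel sets \<open>{v. k < g v}\<close>.\<close>

lemma cut_polytope_inner_le_total_variation:
  fixes G :: "('v::finite, 'e) pre_digraph" and g :: "'v \<Rightarrow> nat"
  assumes fin: "finite (arcs G)" and h: "h \<in> cut_polytope G"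
  shows "(\<Sum>v\<in>UNIV. h $ v * real (g v))
    \<le> 1 / 2 * (\<Sum>e\<in>arcs G. \<bar>real (g (tail G e)) - real (g (head G e))\<bar>)"
proof -
  define N where "N = Max (range g)"
  have le: "g v \<le> N" for v
    by (simp add: N_def)
  have layers: "(\<Sum>k<N. of_bool (a \<le> k \<and> k < b)) = real (b - a)" if "b \<le> N" for a b
  proof -
    have "(\<Sum>k<N. of_bool (a \<le> k \<and> k < b)) = (\<Sum>k\<in>{..<N} \<inter> {k. a \<le> k \<and> k < b}. 1 :: real)"
      by (intro sum.mono_neutral_cong_right) auto
    also have "{..<N} \<inter> {k. a \<le> k \<and> k < b} = {a..<b}"
      using that by auto
    finally show ?thesis
      by simp
  qed
  have cut_card: "real (card (cut_edges G {v. k < g v}))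
      = (\<Sum>e\<in>arcs G. of_bool (g (head G e) \<le> k \<and> k < g (tail G e))
           + of_bool (g (tail G e) \<le> k \<and> k < g (head G e)))" for k
    unfolding dirichlet_form_indicator[OF fin, symmetric] dirichlet_form_def
    by (rule sum.cong) (auto simp: not_less)
  have "(\<Sum>v\<in>UNIV. h $ v * real (g v)) = (\<Sum>v\<in>UNIV. \<Sum>k<N. h $ v * of_bool (k < g v))"
    using layers[OF le, of 0] by (simp flip: sum_distrib_left)
  also have "\<dots> = (\<Sum>k<N. vsum h {v. k < g v})"
    unfolding vsum_def
    by (subst sum.swap) (auto intro!: sum.cong sum.mono_neutral_cong_right)
  also have "\<dots> \<le> (\<Sum>k<N. 1 / 2 * real (card (cut_edges G {v. k < g v})))"
    using h by (intro sum_mono) (auto simp: cut_polytope_def)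
  also have "\<dots> = 1 / 2 * (\<Sum>e\<in>arcs G. \<Sum>k<N. of_bool (g (head G e) \<le> k \<and> k < g (tail G e))
           + of_bool (g (tail G e) \<le> k \<and> k < g (head G e)))"
    unfolding sum_distrib_left[symmetric] cut_card by (subst sum.swap) (rule refl)
  also have "\<dots> = 1 / 2 * (\<Sum>e\<in>arcs G. \<bar>real (g (tail G e)) - real (g (head G e))\<bar>)"
    unfolding sum.distrib[of _ _ "{..<N}"] layers[OF le]
    by (intro arg_cong2[of _ _ _ _ "(*)"] sum.cong refl) auto
  finally show ?thesis .
qed

lemma abs_le_square_of_Ints:
  fixes x :: real
  assumes "x \<in> \<int>"
  shows "\<bar>x\<bar> \<le> x * x"
proof (cases "x = 0")
  case False
  with assms have "1 \<le> \<bar>x\<bar>"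
    by (simp add: Ints_nonzero_abs_ge1)
  then have "\<bar>x\<bar> * 1 \<le> \<bar>x\<bar> * \<bar>x\<bar>"
    by (intro mult_left_mono) auto
  then show ?thesis
    by simp
qed simp

lemma cut_polytope_inner_le_dirichlet:
  fixes G :: "('v::finite, 'e) pre_digraph"
  assumes fin: "finite (arcs G)" and h: "h \<in> cut_polytope G" and g: "\<And>v. g $ v \<in> \<int>"
  shows "h \<bullet> g \<le> 1 / 2 * dirichlet_form G g g"
proof -
  \<comment> \<open>A constant shift makes \<open>g\<close> nonnegative; it does not affect \<open>h \<bullet> g\<close>, as \<open>h\<close> has degree \<open>0\<close>.\<close>
  define m where "m = Min (range (\<lambda>v. \<lfloor>g $ v\<rfloor>))"
  define g' where "g' v = nat (\<lfloor>g $ v\<rfloor> - m)" for v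
  have "m \<le> \<lfloor>g $ v\<rfloor>" for v
    by (simp add: m_def)
  then have g': "real (g' v) = g $ v - of_int m" for v
    using g[of v] by (auto simp: g'_def elim!: Ints_cases)
  have "(\<Sum>v\<in>UNIV. h $ v * real (g' v)) = h \<bullet> g - of_int m * vsum h UNIV"
    by (simp add: g' inner_vec_def vsum_def sum_distrib_left right_diff_distrib sum_subtractf
        mult.commute)
  then have "h \<bullet> g = (\<Sum>v\<in>UNIV. h $ v * real (g' v))"
    using h by (simp add: cut_polytope_def hyperplane_deg_def)
  also have "\<dots> \<le> 1 / 2 * (\<Sum>e\<in>arcs G. \<bar>g $ tail G e - g $ head G e\<bar>)"
    using cut_polytope_inner_le_total_variation[OF fin h, of g'] by (simp add: g')
  also have "\<dots> \<le> 1 / 2 * dirichlet_form G g g"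
    unfolding dirichlet_form_def
    by (intro mult_left_mono sum_mono abs_le_square_of_Ints Ints_diff g) auto
  finally show ?thesis .
qed

lemma voronoi_cell_eq_cut_polytope:
  fixes G :: "('v::finite, 'e) pre_digraph"
  assumes fin: "finite (arcs G)" and verts: "verts G = UNIV"
    and conn: "Digraph_Component.connected G"
  shows "voronoi_cell G = cut_polytope G"
proof (intro equalityI subsetI)
  fix h assume h: "h \<in> voronoi_cell G"
  have "vsum h I \<le> 1 / 2 * real (card (cut_edges G I))" for I
  proof -
    have "vsum h I = h \<bullet> (\<chi> v. of_bool (v \<in> I))"
      by (auto simp: vsum_def inner_vec_def intro!: sum.mono_neutral_cong_left)
    also have "\<dots> \<le> 1 / 2 * real (card (cut_edges G I))"
      unfolding dirichlet_form_indicator[OF fin, symmetric]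
      using h by (simp add: voronoi_cell_iff[OF fin verts conn] of_bool_def)
    finally show ?thesis .
  qed
  with h show "h \<in> cut_polytope G"
    by (simp add: cut_polytope_def voronoi_cell_def)
next
  fix h assume "h \<in> cut_polytope G"
  then show "h \<in> voronoi_cell G"
    using cut_polytope_inner_le_dirichlet[OF fin]
    by (auto simp: voronoi_cell_iff[OF fin verts conn] cut_polytope_def)
qed

section \<open>The center of the semistability polytope\<close>

lemma deg_on_edge_interior:
  assumes "admissible G len D" "e \<in> arcs G"
  shows "deg_on D (edge_interior len e) = of_bool (meets_support len D e)"
proof (cases "\<forall>y\<in>edge_interior len e. Poly_Mapping.lookup D y = 0")
  case True
  then have "edge_interior len e \<inter> Poly_Mapping.keys D = {}"
    by (auto simp: in_keys_iff)
  then show ?thesis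
    by (auto simp: deg_on_def meets_support_def Int_commute)
next
  case False
  then obtain x where x: "x \<in> edge_interior len e" "Poly_Mapping.lookup D x = 1"
    "\<forall>y\<in>edge_interior len e - {x}. Poly_Mapping.lookup D y = 0"
    using assms unfolding admissible_def by blast
  then have "edge_interior len e \<inter> Poly_Mapping.keys D = {x}"
    by (auto simp: in_keys_iff)
  then show ?thesis
    using x(2) by (simp add: deg_on_def meets_support_def Int_commute)
qed

lemma deg_sub_eq:
  fixes G :: "('v::finite, 'e) pre_digraph"
  assumes fin: "finite (arcs G)" and adm: "admissible G len D"
  shows "deg_sub G len D I = (\<Sum>v\<in>I. Poly_Mapping.lookup D (Vertex v))
    + (\<Sum>e\<in>arcs G. of_bool (tail G e \<in> I \<and> head G e \<in> I \<and> meets_support len D e))"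
proof -
  define A where "A = {e \<in> arcs G. tail G e \<in> I \<and> head G e \<in> I}"
  have finA: "finite A"
    using fin by (simp add: A_def)
  let ?K = "Poly_Mapping.keys D"
  have split: "?K \<inter> sub_metric_graph G len I
      = (?K \<inter> Vertex ` I) \<union> (\<Union>e\<in>A. ?K \<inter> edge_interior len e)"
    by (auto simp: sub_metric_graph_def A_def)
  have "deg_sub G len D I = (\<Sum>x\<in>?K \<inter> Vertex ` I. Poly_Mapping.lookup D x)
      + (\<Sum>x\<in>(\<Union>e\<in>A. ?K \<inter> edge_interior len e). Poly_Mapping.lookup D x)"
    unfolding deg_sub_def deg_on_def split using finA
    by (intro sum.union_disjoint) (auto simp: edge_interior_def)
  also have "(\<Sum>x\<in>?K \<inter> Vertex ` I. Poly_Mapping.lookup D x)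
      = (\<Sum>x\<in>Vertex ` I. Poly_Mapping.lookup D x)"
    by (rule sum.mono_neutral_left) (auto simp: in_keys_iff)
  also have "\<dots> = (\<Sum>v\<in>I. Poly_Mapping.lookup D (Vertex v))"
    by (simp add: sum.reindex inj_on_def)
  also have "(\<Sum>x\<in>(\<Union>e\<in>A. ?K \<inter> edge_interior len e). Poly_Mapping.lookup D x)
      = (\<Sum>e\<in>A. deg_on D (edge_interior len e))"
    unfolding deg_on_def using finA
    by (intro sum.UNION_disjoint) (auto simp: edge_interior_def)
  also have "\<dots> = (\<Sum>e\<in>A. of_bool (meets_support len D e))"
    using deg_on_edge_interior[OF adm] by (simp add: A_def)
  also have "\<dots> = (\<Sum>e\<in>arcs G. of_bool (tail G e \<in> I \<and> head G e \<in> I \<and> meets_support len D e))"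
    using fin by (intro sum.mono_neutral_cong_left) (auto simp: A_def)
  finally show ?thesis .
qed

lemma divisor_degree_eq_deg_sub_UNIV:
  fixes G :: "('v::finite, 'e) pre_digraph"
  assumes "verts G = UNIV"
  shows "divisor_degree G len D = deg_sub G len D UNIV"
  using assms
  by (simp add: divisor_degree_def deg_sub_def metric_graph_def sub_metric_graph_def)

text \<open>
  The right-hand side is modular because each interior point of the support can be pushed in equal
  halves to the two ends of its edge: an edge inside \<open>I\<close> then contributes \<open>1\<close>, an edge of the
  cut contributes \<open>1 / 2\<close>. This yields the coordinates of \<open>q_D\<close>; a loop returns both halves to
  the same vertex.
\<close>

lemma vsum_q_point:
  fixes G :: "('v::finite, 'e) pre_digraph"
  assumes fin: "finite (arcs G)" and verts: "verts G = UNIV" and adm: "admissible G len D"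
  shows "vsum (q_point G len D) I = of_int (deg_sub G len D I)
    + 1 / 2 * real (card {e \<in> cut_edges G I. meets_support len D e})"
proof -
  let ?P = "\<lambda>q. q \<in> hyperplane_deg (of_int (divisor_degree G len D)) \<and>
    (\<forall>I. vsum q I = of_int (deg_sub G len D I)
      + 1 / 2 * real (card {e \<in> cut_edges G I. meets_support len D e}))"
  define m :: "'e \<Rightarrow> real" where "m e = of_bool (meets_support len D e)" for e
  define q :: "real ^ 'v" where "q = (\<chi> v. of_int (Poly_Mapping.lookup D (Vertex v))
    + (\<Sum>e\<in>arcs G. 1 / 2 * m e * (of_bool (tail G e = v) + of_bool (head G e = v))))"
  have card_met: "real (card {e \<in> cut_edges G I. meets_support len D e})
      = (\<Sum>e\<in>arcs G. of_bool (e \<in> cut_edges G I) * m e)" for I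
  proof -
    have "real (card {e \<in> cut_edges G I. meets_support len D e})
        = (\<Sum>e\<in>{e \<in> cut_edges G I. meets_support len D e}. 1)"
      by simp
    also have "\<dots> = (\<Sum>e\<in>arcs G. of_bool (e \<in> cut_edges G I) * m e)"
      using fin by (intro sum.mono_neutral_cong_left) (auto simp: m_def cut_edges_def)
    finally show ?thesis .
  qed
  have q: "vsum q I = of_int (deg_sub G len D I)
      + 1 / 2 * real (card {e \<in> cut_edges G I. meets_support len D e})" for I
  proof -
    have "vsum q I = (\<Sum>v\<in>I. of_int (Poly_Mapping.lookup D (Vertex v)))
        + (\<Sum>e\<in>arcs G. \<Sum>v\<in>I. 1 / 2 * m e * (of_bool (tail G e = v) + of_bool (head G e = v)))"
      by (simp add: vsum_def q_def sum.distrib sum.swap[of _ I "arcs G"])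
    also have "\<dots> = (\<Sum>v\<in>I. of_int (Poly_Mapping.lookup D (Vertex v)))
        + (\<Sum>e\<in>arcs G. 1 / 2 * m e * (of_bool (tail G e \<in> I) + of_bool (head G e \<in> I)))"
      by (simp only: sum_distrib_left[symmetric] sum.distrib)
        (simp add: of_bool_def)
    also have "\<dots> = (\<Sum>v\<in>I. of_int (Poly_Mapping.lookup D (Vertex v)))
        + (\<Sum>e\<in>arcs G. of_bool (tail G e \<in> I \<and> head G e \<in> I \<and> meets_support len D e)
            + 1 / 2 * (of_bool (e \<in> cut_edges G I) * m e))"
      by (intro arg_cong2[of _ _ _ _ "(+)"] sum.cong refl) (auto simp: m_def cut_edges_def)
    finally show ?thesis
      by (simp add: deg_sub_eq[OF fin adm] card_met sum.distrib sum_distrib_left)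
  qed
  have "?P q"
    using q[of UNIV] q
    by (simp add: hyperplane_deg_def divisor_degree_eq_deg_sub_UNIV[OF verts] cut_edges_def)
  moreover have "q' = q" if "?P q'" for q'
  proof -
    have "vsum q' {v} = vsum q {v}" for v
      using that q by metis
    then show ?thesis
      by (simp add: vec_eq_iff vsum_def)
  qed
  ultimately have "?P (q_point G len D)"
    unfolding q_point_def by (rule theI)
  then show ?thesis
    by blast
qed

section \<open>The semistability polytope is cut out by the cut inequalities\<close>

lemma vsum_add: "vsum (p + q) I = vsum p I + vsum q I"
  by (simp add: vsum_def sum.distrib)

lemma vsum_compl: "vsum h (- I) = vsum h UNIV - vsum h I"
  using sum.subset_diff[of I UNIV "($) h"] by (simp add: vsum_def Compl_eq_Diff_UNIV)

lemma cut_edges_compl: "cut_edges G (- I) = cut_edges G I"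
  by (auto simp: cut_edges_def)

lemma card_cut_edges_support_free:
  assumes "finite (arcs G)"
  shows "card (cut_edges G I) = card (cut_edges (support_free_subgraph G len D) I)
    + card {e \<in> cut_edges G I. meets_support len D e}"
proof -
  have "cut_edges G I = cut_edges (support_free_subgraph G len D) I
      \<union> {e \<in> cut_edges G I. meets_support len D e}"
    by (auto simp: cut_edges_def support_free_subgraph_def)
  moreover have "cut_edges (support_free_subgraph G len D) I
      \<inter> {e \<in> cut_edges G I. meets_support len D e} = {}"
    by (auto simp: cut_edges_def support_free_subgraph_def)
  ultimately show ?thesis
    using assms
    by (metis (no_types, lifting) card_Un_disjoint cut_edges_def finite_Un finite_subset
        mem_Collect_eq subsetI)
qed

text \<open>
  Substituting \<open>q_D\<close> turns semistability at \<open>I\<close> into \<open>- c / 2 - \<delta> \<le> h(I) \<le> c / 2\<close>, where \<open>c\<close> counts the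
  cut in \<open>G\<^sub>D\<close> and \<open>\<delta>\<close> the remaining edges of the cut. The slack \<open>\<delta>\<close> in the lower bound gains
  nothing, because the upper bound at the complement of \<open>I\<close> already gives \<open>- c / 2 \<le> h(I)\<close>.
\<close>

lemma semistability_polytope_translate_iff:
  fixes G :: "('v::finite, 'e) pre_digraph"
  assumes fin: "finite (arcs G)" and verts: "verts G = UNIV" and adm: "admissible G len D"
  shows "h + q_point G len D \<in> semistability_polytope G len D
    \<longleftrightarrow> h \<in> cut_polytope (support_free_subgraph G len D)"
proof -
  let ?c = "\<lambda>I. real (card (cut_edges (support_free_subgraph G len D) I))"
  let ?\<delta> = "\<lambda>I. real (card {e \<in> cut_edges G I. meets_support len D e})"
  have deg: "h + q_point G len D \<in> hyperplane_deg (of_int (divisor_degree G len D))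
      \<longleftrightarrow> vsum h UNIV = 0"
    using vsum_q_point[OF fin verts adm, of UNIV]
    by (simp add: hyperplane_deg_def vsum_add divisor_degree_eq_deg_sub_UNIV[OF verts] cut_edges_def)
  have ineq: "\<bar>of_int (deg_sub G len D I) - vsum (h + q_point G len D) I\<bar>
        \<le> 1 / 2 * real (card (cut_edges G I))
      \<longleftrightarrow> vsum h I \<le> 1 / 2 * ?c I \<and> - vsum h I \<le> 1 / 2 * ?c I + ?\<delta> I" for I
    unfolding vsum_add vsum_q_point[OF fin verts adm]
      card_cut_edges_support_free[OF fin, of I len D]
    by (auto simp: abs_le_iff field_simps)
  have cuts: "(\<forall>I. I \<noteq> {} \<and> I \<noteq> UNIV \<longrightarrow>
            vsum h I \<le> 1 / 2 * ?c I \<and> - vsum h I \<le> 1 / 2 * ?c I + ?\<delta> I)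
      \<longleftrightarrow> (\<forall>I. vsum h I \<le> 1 / 2 * ?c I)" if h0: "vsum h UNIV = 0"
  proof (intro iffI allI impI)
    fix I
    assume *: "\<forall>I. I \<noteq> {} \<and> I \<noteq> UNIV \<longrightarrow>
      vsum h I \<le> 1 / 2 * ?c I \<and> - vsum h I \<le> 1 / 2 * ?c I + ?\<delta> I"
    show "vsum h I \<le> 1 / 2 * ?c I"
    proof (cases "I = {} \<or> I = UNIV")
      case True
      then have "vsum h I = 0"
        using h0 by (auto simp: vsum_def)
      then show ?thesis
        by simp
    qed (use * in blast)
  next
    fix I
    assume *: "\<forall>I. vsum h I \<le> 1 / 2 * ?c I"
    have "- vsum h I \<le> 1 / 2 * ?c I"
      using *[rule_format, of "- I"] h0 by (simp add: vsum_compl cut_edges_compl)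
    with * show "vsum h I \<le> 1 / 2 * ?c I \<and> - vsum h I \<le> 1 / 2 * ?c I + ?\<delta> I"
      by (simp add: add_increasing2)
  qed
  have hyp: "h \<in> hyperplane_deg 0 \<longleftrightarrow> vsum h UNIV = 0"
    by (simp add: hyperplane_deg_def)
  show ?thesis
    unfolding semistability_polytope_def cut_polytope_def mem_Collect_eq deg ineq hyp
    by (rule conj_cong[OF refl cuts])
qed

theorem theorem4p11:
  fixes G :: "('v::finite, 'e) pre_digraph"
    and len :: "'e \<Rightarrow> real"
    and D :: "('v, 'e) mpoint \<Rightarrow>\<^sub>0 int"
  assumes "fin_digraph G"
    and "verts G = UNIV"
    and "Digraph_Component.connected G"
    and "\<And>e. e \<in> arcs G \<Longrightarrow> len e > 0"
    and "is_divisor G len D"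
    and "admissible G len D"
    and "Digraph_Component.connected (support_free_subgraph G len D)"
  shows "semistability_polytope G len D
           = (\<lambda>h. h + q_point G len D) ` voronoi_cell (support_free_subgraph G len D)"
proof -
  let ?H = "support_free_subgraph G len D" and ?q = "q_point G len D"
  have fin: "finite (arcs G)"
    using assms(1) by (rule fin_digraph.finite_arcs)
  have "voronoi_cell ?H = cut_polytope ?H"
    using fin assms(2,7)
    by (intro voronoi_cell_eq_cut_polytope) (auto simp: support_free_subgraph_def)
  moreover have "q \<in> semistability_polytope G len D \<longleftrightarrow> q - ?q \<in> cut_polytope ?H" for q
    using semistability_polytope_translate_iff[OF fin assms(2,6), of "q - ?q"] by simp
  ultimately show ?thesis
    by (auto simp: image_iff) (metis diff_add_cancel)
qed

end
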